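(* Let $\mathcal G\subset\mathrm{SU}(2)$ be any finite universal gate set. The algorithm $\mathrm{IFSK}$ described in the context solves the problem of approximating a qubit gate $U$ within error $\epsilon$ with gate sequences of length $O(\log^{\gamma}\epsilon^{-1})$, where $$\gamma=\frac{\log 33}{\log(3/2)}\approx 8.62 .$$ That is, there is a constant $K$ such that for every sufficiently small $\epsilon>0$ there is a recursion depth $n$ for which, for every $U\in\mathrm{SU}(2)$, $\mathrm{IFSK}(U,n)$ is a sequence of at most $K\log^{\gamma}(\epsilon^{-1})$ elements of $\mathcal G$ whose product $U_n$ satisfies $\|U_n-U\|\le\epsilon$.
   Context: $\|\cdot\|$ is the operator norm. A gate set $\mathcal G\subset\mathrm{SU}(2)$ is universal if the set of finite products of elements of $\mathcal G$ (no inverses allowed unless in $\mathcal G$) is dense in $\mathrm{SU}(2)$. The constant $K$ may depend on $\mathcal G$. Gate sequences are identified with words over $\mathcal G$, composed by concatenation; the matrix (product) of a sequence is always available classically. Pauli operators: $X=\begin{pmatrix}0&1\\1&0\end{pmatrix}$, $Y=\begin{pmatrix}0&-i\\i&0\end{pmatrix}$; note $iX,iY\in\mathrm{SU}(2)$. Group commutator subroutine: given $\Delta\in\mathrm{SU}(2)$ with $\|\Delta-I\|\le\delta$, $\mathrm{ApproximateGroupCommutator}(\Delta)$ returns $V,W\in\mathrm{SU}(2)$ with $\|VWV^\dagger W^\dagger-\Delta\|=O(\delta^{3/2})$, $\|V-I\|=O(\delta^{1/2})$ and $\|W-I\|=O(\delta^{1/2})$ (such $V,W$ exist, with universal constants).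 Algorithm $\mathrm{IFSK}(U,n)$ for $U\in\mathrm{SU}(2)$ and an integer $n\ge0$: (0) If $n=0$, return a word over $\mathcal G$ from a fixed finite set of words whose products form an $\epsilon_0$-net of $\mathrm{SU}(2)$, with product within $\epsilon_0$ of $U$; here $\epsilon_0>0$ is a sufficiently small absolute constant. (1) If $n\ge1$, compute $U_{n-1}=\mathrm{IFSK}(U,n-1)$ and $(V,W)=\mathrm{ApproximateGroupCommutator}(UU_{n-1}^\dagger)$. (2) Compute $V_{n-1}=\mathrm{IFSK}(V,n-1)$, $W_{n-1}=\mathrm{IFSK}(W,n-1)$, $\widehat{V_{n-1}^\dagger}=\mathrm{IFSK}(V_{n-1}^\dagger,n-1)$, $\widehat{W_{n-1}^\dagger}=\mathrm{IFSK}(W_{n-1}^\dagger,n-1)$, $X_{n-1}=\mathrm{IFSK}(iX,n-1)$, $Y_{n-1}=\mathrm{IFSK}(iY,n-1)$. (3) For each $T\in\{V,W\}$ form the word $$\widetilde{T_{n-1}^\dagger}=X_{n-1}\widehat{T_{n-1}^\dagger}T_{n-1}\,Y_{n-1}X_{n-1}\widehat{T_{n-1}^\dagger}T_{n-1}\,Y_{n-1}^2X_{n-1}\widehat{T_{n-1}^\dagger}T_{n-1}\,Y_{n-1}X_{n-1}\widehat{T_{n-1}^\dagger}.$$ (4) Return $U_n=V_{n-1}\,W_{n-1}\,\widetilde{V_{n-1}^\dagger}\,\widetilde{W_{n-1}^\dagger}\,U_{n-1}$. *)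

theory Defs
  imports "HOL-Analysis.Analysis"
begin

type_synonym cmat2 = "complex^2^2"

definition dagger :: "cmat2 \<Rightarrow> cmat2" where
  "dagger A = (\<chi> i j. cnj (A $ j $ i))"

definition SU2 :: "cmat2 set" where
  "SU2 = {A. dagger A ** A = mat 1 \<and> A ** dagger A = mat 1 \<and> det A = 1}"

(* The class norm on cmat2 is the Frobenius norm, so the operator norm (with respect to
   the Euclidean norm on complex^2) has to be taken explicitly. *)
definition opnorm :: "cmat2 \<Rightarrow> real" where
  "opnorm A = onorm (\<lambda>v. A *v v)"

definition pauli_X :: cmat2 where
  "pauli_X = vector [vector [0, 1], vector [1, 0]]"

definition pauli_Y :: cmat2 where
  "pauli_Y = vector [vector [0, - \<i>], vector [\<i>, 0]]"

(* A word denotes the product of its letters in reading order, so that concatenation of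
   words corresponds to the matrix product in the same order. *)
definition word_prod :: "cmat2 list \<Rightarrow> cmat2" where
  "word_prod w = foldr (**) w (mat 1)"

(* The topology of cmat2 is the one induced by opnorm, as all norms are equivalent. *)
definition universal :: "cmat2 set \<Rightarrow> bool" where
  "universal \<G> \<longleftrightarrow> SU2 \<subseteq> closure (word_prod ` lists \<G>)"

definition word_net :: "cmat2 set \<Rightarrow> real \<Rightarrow> cmat2 list set \<Rightarrow> bool" where
  "word_net \<G> \<epsilon>\<^sub>0 N \<longleftrightarrow>
     finite N \<and> N \<subseteq> lists \<G> \<and> (\<forall>U\<in>SU2. \<exists>w\<in>N. opnorm (word_prod w - U) \<le> \<epsilon>\<^sub>0)"

definition net_lookup :: "cmat2 list set \<Rightarrow> real \<Rightarrow> (cmat2 \<Rightarrow> cmat2 list) \<Rightarrow> bool" where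
  "net_lookup N \<epsilon>\<^sub>0 base \<longleftrightarrow>
     (\<forall>U\<in>SU2. base U \<in> N \<and> opnorm (word_prod (base U) - U) \<le> \<epsilon>\<^sub>0)"

(* C is a common constant for the three O-bounds. *)
definition approx_group_commutator :: "real \<Rightarrow> (cmat2 \<Rightarrow> cmat2 \<times> cmat2) \<Rightarrow> bool" where
  "approx_group_commutator C gc \<longleftrightarrow>
     (\<forall>\<Delta>\<in>SU2. \<forall>\<delta>. opnorm (\<Delta> - mat 1) \<le> \<delta> \<longrightarrow>
        (case gc \<Delta> of (V, W) \<Rightarrow>
           V \<in> SU2 \<and> W \<in> SU2 \<and>
           opnorm (V ** W ** dagger V ** dagger W - \<Delta>) \<le> C * \<delta> powr (3/2) \<and>
           opnorm (V - mat 1) \<le> C * \<delta> powr (1/2) \<and>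
           opnorm (W - mat 1) \<le> C * \<delta> powr (1/2)))"

definition inverse_word ::
  "cmat2 list \<Rightarrow> cmat2 list \<Rightarrow> cmat2 list \<Rightarrow> cmat2 list \<Rightarrow> cmat2 list" where
  "inverse_word X Y T That =
     X @ That @ T @ Y @ X @ That @ T @ Y @ Y @ X @ That @ T @ Y @ X @ That"

(* mat \<i> ** pauli_X is the scalar multiple iX, and likewise for Y. *)
primrec ifsk ::
  "(cmat2 \<Rightarrow> cmat2 list) \<Rightarrow> (cmat2 \<Rightarrow> cmat2 \<times> cmat2) \<Rightarrow> nat \<Rightarrow> cmat2 \<Rightarrow> cmat2 list" where
  "ifsk base gc 0 = base"
| "ifsk base gc (Suc n) = (\<lambda>U.
     let prev = ifsk base gc n;
         U1 = prev U;
         (V, W) = gc (U ** dagger (word_prod U1));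
         V1 = prev V;
         W1 = prev W;
         Vhat = prev (dagger (word_prod V1));
         What = prev (dagger (word_prod W1));
         X1 = prev (mat \<i> ** pauli_X);
         Y1 = prev (mat \<i> ** pauli_Y)
     in V1 @ W1 @ inverse_word X1 Y1 V1 Vhat @ inverse_word X1 Y1 W1 What @ U1)"

end

theory Submission
  imports Defs
begin

text \<open>Write the inverse word as a product of near-identity factors conjugated by Pauli operators.
  The defect \<open>A\<close> of \<open>X That T\<close> and the defect \<open>B\<close> of \<open>Y\<close> are each conjugated once by every
  element of the Pauli group modulo phases, so the first-order error is a multiple of the traces of
  \<open>A - I\<close> and \<open>B - I\<close>, which are quadratically small on \<open>SU(2)\<close>. Hence the approximate inverse
  has error \<open>O(\<epsilon>\<^sup>2)\<close>, the usual Solovay-Kitaev commutator estimate applies, and one recursion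
  step takes an error \<open>\<epsilon>\<close> to \<open>D \<epsilon> powr (3/2)\<close> while multiplying the word length by 33. With
  \<open>\<epsilon>\<^sub>0 \<le> exp (- 1) / D\<^sup>2\<close> the error at depth \<open>n\<close> is at most \<open>exp (- ((3/2) ^ n)) / D\<^sup>2\<close>,
  so \<open>(3/2) ^ n\<close> of order \<open>ln (1 / \<epsilon>)\<close> suffices.\<close>

section \<open>Algebra of 2 by 2 complex matrices and SU(2)\<close>

lemma cmat2_eq_iff:
  fixes A B :: cmat2
  shows "A = B \<longleftrightarrow> A$1$1 = B$1$1 \<and> A$1$2 = B$1$2 \<and> A$2$1 = B$2$1 \<and> A$2$2 = B$2$2"
  by (auto simp: vec_eq_iff forall_2)

lemma cmat2_mult_component: "((A::cmat2) ** B) $ i $ j = A$i$1 * B$1$j + A$i$2 * B$2$j"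
  by (simp add: matrix_matrix_mult_def sum_2)

lemma cmat2_add_mult: "((A::cmat2) + B) ** M = A ** M + B ** M"
  and cmat2_mult_add: "M ** (A + B) = M ** A + M ** B"
  and cmat2_diff_mult: "(A - B) ** M = A ** M - B ** M"
  and cmat2_mult_diff: "M ** (A - B) = M ** A - M ** B"
  and cmat2_minus_mult: "(- A) ** M = - (A ** M)"
  and cmat2_mult_minus: "M ** (- A) = - (M ** A)"
  by (simp_all add: cmat2_eq_iff cmat2_mult_component algebra_simps)

text \<open>Expands to sums of left-associated monomials, so that the noncommutative identities
  behind the norm estimates can be checked by simplification.\<close>

lemmas cmat2_ring_simps = cmat2_add_mult cmat2_mult_add cmat2_diff_mult cmat2_mult_diff
  cmat2_minus_mult cmat2_mult_minus matrix_mul_assoc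

lemma dagger_component: "dagger A $ i $ j = cnj (A $ j $ i)"
  by (simp add: dagger_def)

lemma dagger_mult: "dagger (A ** B) = dagger B ** dagger A"
  by (simp add: cmat2_eq_iff cmat2_mult_component dagger_component algebra_simps)

lemma dagger_dagger [simp]: "dagger (dagger A) = A"
  by (simp add: cmat2_eq_iff dagger_component)

lemma dagger_one [simp]: "dagger (mat 1) = mat 1"
  by (simp add: cmat2_eq_iff dagger_component mat_def)

lemma SU2_dagger_mult: "A \<in> SU2 \<Longrightarrow> dagger A ** A = mat 1"
  and SU2_mult_dagger: "A \<in> SU2 \<Longrightarrow> A ** dagger A = mat 1"
  by (auto simp: SU2_def)

text \<open>Cancellation inside right-associated products, for use together with
  \<open>matrix_mul_assoc[symmetric]\<close>.\<close>

lemma SU2_dagger_mult_left: "A \<in> SU2 \<Longrightarrow> dagger A ** (A ** B) = B"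
  and SU2_mult_dagger_left: "A \<in> SU2 \<Longrightarrow> A ** (dagger A ** B) = B"
  by (simp_all add: matrix_mul_assoc SU2_dagger_mult SU2_mult_dagger)

lemma det_dagger: "det (dagger A) = cnj (det A)"
  by (simp add: det_2 dagger_component algebra_simps)

lemma SU2_one: "mat 1 \<in> SU2"
  by (simp add: SU2_def)

lemma SU2_dagger: "A \<in> SU2 \<Longrightarrow> dagger A \<in> SU2"
  by (simp add: SU2_def det_dagger)

lemma SU2_mult:
  assumes "A \<in> SU2" "B \<in> SU2" shows "A ** B \<in> SU2"
proof -
  have "dagger (A ** B) ** (A ** B) = mat 1" "(A ** B) ** dagger (A ** B) = mat 1"
    using assms
    by (simp_all add: dagger_mult matrix_mul_assoc[symmetric] SU2_dagger_mult_left
      SU2_mult_dagger_left SU2_dagger_mult SU2_mult_dagger)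
  then show ?thesis using assms by (simp add: SU2_def det_mul)
qed

lemma word_prod_append: "word_prod (u @ v) = word_prod u ** word_prod v"
  by (induction u) (simp_all add: word_prod_def matrix_mul_assoc)

lemma word_prod_SU2: "w \<in> lists SU2 \<Longrightarrow> word_prod w \<in> SU2"
  by (induction w) (auto simp: word_prod_def SU2_one SU2_mult)

lemma SU2_entries:
  assumes "A \<in> SU2"
  shows "A$2$1 = - cnj (A$1$2)" "A$2$2 = cnj (A$1$1)"
    "A$1$1 * cnj (A$1$1) + A$1$2 * cnj (A$1$2) = 1"
proof -
  have d: "A$1$1 * A$2$2 - A$1$2 * A$2$1 = 1"
    using assms by (simp add: SU2_def det_2)
  have u: "A$1$1 * cnj (A$1$1) + A$1$2 * cnj (A$1$2) = 1"
    "A$2$1 * cnj (A$1$1) + A$2$2 * cnj (A$1$2) = 0"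
    using SU2_mult_dagger[OF assms]
    by (simp_all add: cmat2_eq_iff cmat2_mult_component dagger_component mat_def)
  \<comment> \<open>Cramer's rule: orthogonality of the rows and \<open>det A = 1\<close> form a
    linear system for the second row, whose determinant is the squared norm of the first row, that
    is 1.\<close>
  have "A$2$1 = A$2$1 * (A$1$1 * cnj (A$1$1) + A$1$2 * cnj (A$1$2))"
    using u by simp
  also have "\<dots> = A$1$1 * (A$2$1 * cnj (A$1$1) + A$2$2 * cnj (A$1$2))
      - cnj (A$1$2) * (A$1$1 * A$2$2 - A$1$2 * A$2$1)"
    by (simp only: ring_distribs ac_simps) simp
  finally show "A$2$1 = - cnj (A$1$2)" using d u by simp
  have "A$2$2 = A$2$2 * (A$1$1 * cnj (A$1$1) + A$1$2 * cnj (A$1$2))"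
    using u by simp
  also have "\<dots> = A$1$2 * (A$2$1 * cnj (A$1$1) + A$2$2 * cnj (A$1$2))
      + cnj (A$1$1) * (A$1$1 * A$2$2 - A$1$2 * A$2$1)"
    by (simp only: ring_distribs ac_simps) simp
  finally show "A$2$2 = cnj (A$1$1)" using d u by simp
  show "A$1$1 * cnj (A$1$1) + A$1$2 * cnj (A$1$2) = 1" by (rule u)
qed

section \<open>The operator norm and its invariance under SU(2)\<close>

lemma opnorm_mult_vec_le: "norm (A *v v) \<le> opnorm A * norm v"
  unfolding opnorm_def by (rule onorm) simp

lemma opnorm_leI: "(\<And>v. norm (A *v v) \<le> b * norm v) \<Longrightarrow> opnorm A \<le> b"
  unfolding opnorm_def by (rule onorm_le)

lemma opnorm_nonneg: "0 \<le> opnorm A"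
  unfolding opnorm_def by (rule onorm_pos_le) simp

lemma opnorm_zero [simp]: "opnorm 0 = 0"
  by (simp add: opnorm_def onorm_zero)

lemma opnorm_add: "opnorm (A + B) \<le> opnorm A + opnorm B"
  unfolding opnorm_def matrix_vector_mult_add_rdistrib by (rule onorm_triangle) simp_all

lemma opnorm_minus [simp]: "opnorm (- A) = opnorm A"
proof -
  have "(- A) *v v = - (A *v v)" for v
    using matrix_vector_mult_diff_rdistrib[of 0 A v] by simp
  then show ?thesis by (simp add: opnorm_def onorm_neg)
qed

lemma opnorm_diff: "opnorm (A - B) \<le> opnorm A + opnorm B"
  using opnorm_add[of A "- B"] by simp

lemma opnorm_minus_commute: "opnorm (A - B) = opnorm (B - A)"
  using opnorm_minus[of "A - B"] by simp

lemma opnorm_mult: "opnorm (A ** B) \<le> opnorm A * opnorm B"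
proof (rule opnorm_leI)
  fix v :: "complex^2"
  have "norm (A ** B *v v) \<le> opnorm A * norm (B *v v)"
    by (metis matrix_vector_mul_assoc opnorm_mult_vec_le)
  also have "\<dots> \<le> opnorm A * (opnorm B * norm v)"
    by (intro mult_left_mono opnorm_mult_vec_le opnorm_nonneg)
  finally show "norm (A ** B *v v) \<le> opnorm A * opnorm B * norm v" by simp
qed

lemma opnorm_mult_le: "opnorm A \<le> a \<Longrightarrow> opnorm B \<le> b \<Longrightarrow> opnorm (A ** B) \<le> a * b"
  by (meson opnorm_mult opnorm_nonneg mult_mono order_trans)

lemma opnorm_SU2:
  assumes "A \<in> SU2" shows "opnorm A \<le> 1"
proof (rule opnorm_leI)
  fix v :: "complex^2"
  define a b x y where "a = A$1$1" "b = A$1$2" "x = v$1" "y = v$2"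
  note e = SU2_entries[OF assms, folded a_b_x_y_def]
  \<comment> \<open>Multiplicativity of the quaternion norm: the cross terms cancel. It is stated
    over the complex numbers so that squared moduli become products
    \<open>z * cnj z\<close>.\<close>
  have "complex_of_real ((cmod (a*x + b*y))\<^sup>2 + (cmod (- cnj b * x + cnj a * y))\<^sup>2)
      = (a * cnj a + b * cnj b) * (x * cnj x + y * cnj y)"
    by (simp add: complex_norm_square algebra_simps del: of_real_power)
  also have "\<dots> = complex_of_real ((cmod x)\<^sup>2 + (cmod y)\<^sup>2)"
    by (simp add: complex_norm_square e del: of_real_power)
  finally have "(cmod (a*x + b*y))\<^sup>2 + (cmod (- cnj b * x + cnj a * y))\<^sup>2 = (cmod x)\<^sup>2 + (cmod y)\<^sup>2"
    by (simp only: of_real_eq_iff)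
  then have "norm (A *v v) = norm v"
    using e by (simp add: norm_vec_def L2_set_def sum_2 matrix_vector_mult_def a_b_x_y_def)
  then show "norm (A *v v) \<le> 1 * norm v" by simp
qed

text \<open>Multiplication by \<open>A\<close> does not increase the norm, and undoing it by
  \<open>dagger A\<close> does not either.\<close>

lemma opnorm_mult_SU2:
  assumes "A \<in> SU2" shows "opnorm (A ** B) = opnorm B" "opnorm (B ** A) = opnorm B"
proof -
  have 1: "opnorm (M ** B) \<le> opnorm B" "opnorm (B ** M) \<le> opnorm B" if "M \<in> SU2" for M B
    using opnorm_mult_le[OF opnorm_SU2[OF that] order_refl, of B]
      opnorm_mult_le[OF order_refl opnorm_SU2[OF that], of B] by simp_all
  show "opnorm (A ** B) = opnorm B"
    using 1(1)[OF assms, of B] 1(1)[OF SU2_dagger[OF assms], of "A ** B"]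
    by (simp add: SU2_dagger_mult_left[OF assms])
  have "B ** A ** dagger A = B"
    by (metis SU2_mult_dagger assms matrix_mul_assoc matrix_mul_rid)
  then show "opnorm (B ** A) = opnorm B"
    using 1(2)[OF assms, of B] 1(2)[OF SU2_dagger[OF assms], of "B ** A"] by simp
qed

lemma opnorm_dagger_diff:
  assumes "A \<in> SU2" "B \<in> SU2" shows "opnorm (dagger A - dagger B) = opnorm (A - B)"
proof -
  have "dagger A - dagger B = dagger A ** ((B - A) ** dagger B)"
    using assms by (simp add: cmat2_ring_simps SU2_dagger_mult)
      (metis SU2_mult_dagger matrix_mul_assoc matrix_mul_rid)
  then show ?thesis
    by (metis assms SU2_dagger opnorm_mult_SU2 opnorm_minus_commute)
qed

text \<open>In the telescoped difference the two errors are multiplied by \<open>A\<close> and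
  \<open>B'\<close>, which preserve the norm, so the errors add without a cross term.\<close>

lemma opnorm_mult_diff_le:
  assumes "A \<in> SU2" "B' \<in> SU2" "opnorm (A - A') \<le> a" "opnorm (B - B') \<le> b"
  shows "opnorm (A ** B - A' ** B') \<le> a + b"
proof -
  have "A ** B - A' ** B' = A ** (B - B') + (A - A') ** B'"
    by (simp add: cmat2_ring_simps)
  then show ?thesis
    using opnorm_add[of "A ** (B - B')" "(A - A') ** B'"] assms by (simp add: opnorm_mult_SU2)
qed

section \<open>Finite nets of words from compactness\<close>

lemma opnorm_le_norm: "opnorm A \<le> 4 * norm A"
proof (rule opnorm_leI)
  fix v :: "complex^2"
  have 1: "cmod (A$i$j * v$j) \<le> norm A * norm v" for i j
    unfolding norm_mult
    by (intro mult_mono order_trans[of "cmod (A$i$j)" "norm (A$i)" "norm A"]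
        Finite_Cartesian_Product.norm_nth_le) simp_all
  have 2: "cmod ((A *v v) $ i) \<le> 2 * (norm A * norm v)" for i
    using norm_triangle_ineq[of "A$i$1 * v$1" "A$i$2 * v$2"] 1[of i 1] 1[of i 2]
    by (simp add: matrix_vector_mult_def sum_2)
  have "norm (A *v v) \<le> cmod ((A *v v) $ 1) + cmod ((A *v v) $ 2)"
    unfolding norm_vec_def using L2_set_le_sum[of UNIV "\<lambda>i. cmod ((A *v v) $ i)"] by (simp add: sum_2)
  then show "norm (A *v v) \<le> 4 * norm A * norm v"
    using 2[of 1] 2[of 2] by simp
qed

text \<open>The columns are images of unit vectors under a contraction, so each of the four entries
  has modulus at most 1.\<close>

lemma bounded_SU2: "bounded SU2"
proof (rule boundedI)
  fix A assume A: "A \<in> SU2"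
  have col: "norm (A *v axis j 1) \<le> 1" for j
    using opnorm_mult_vec_le[of A "axis j 1"] opnorm_SU2[OF A] by simp
  have e: "cmod (A$i$j) \<le> 1" for i j
  proof -
    have "cmod (A$i$j) = cmod ((A *v axis j 1) $ i)"
      by (simp add: matrix_vector_mult_def axis_def if_distrib[of "(*) _"] cong: if_cong)
    also have "\<dots> \<le> 1" using col[of j] Finite_Cartesian_Product.norm_nth_le order_trans by blast
    finally show ?thesis .
  qed
  have "norm (A$i) \<le> cmod (A$i$1) + cmod (A$i$2)" for i
    unfolding norm_vec_def using L2_set_le_sum[of UNIV "\<lambda>j. cmod (A$i$j)"] by (simp add: sum_2)
  then have "norm (A$i) \<le> 2" for i using e[of i 1] e[of i 2] by (smt (verit))
  moreover have "norm A \<le> norm (A$1) + norm (A$2)"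
    using L2_set_le_sum[of UNIV "\<lambda>i. norm (A$i)"] by (simp add: sum_2 norm_vec_def[of A])
  ultimately show "norm A \<le> 4" by (smt (verit))
qed

lemma word_net_exists:
  assumes "universal \<G>" "0 < \<epsilon>" shows "\<exists>N. word_net \<G> \<epsilon> N"
proof -
  \<comment> \<open>Density and covering each cost one radius \<open>r\<close> in the class norm,
    and \<open>opnorm_le_norm\<close> costs a factor 4, hence 8.\<close>
  define r where "r = \<epsilon> / 8"
  have r: "r > 0" using assms by (simp add: r_def)
  \<comment> \<open>Passing to the closure turns boundedness into compactness. The centres of the
    cover lie in \<open>closure SU2\<close>, where words are still dense.\<close>
  have "seq_compact (closure SU2)" 
    by (intro compact_imp_seq_compact) (simp add: bounded_SU2)
  then obtain k where k: "finite k" "k \<subseteq> closure SU2" "closure SU2 \<subseteq> (\<Union>x\<in>k. ball x r)"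
    using seq_compact_imp_totally_bounded[THEN spec, THEN mp, OF _ r] by metis
  have "closure SU2 \<subseteq> closure (word_prod ` lists \<G>)"
    using assms by (simp add: universal_def closure_minimal)
  then have "\<exists>w\<in>lists \<G>. dist (word_prod w) x < r" if "x \<in> k" for x
  proof -
    have "x \<in> closure (word_prod ` lists \<G>)"
      using \<open>closure SU2 \<subseteq> closure (word_prod ` lists \<G>)\<close> k(2) that by auto
    then obtain y where "y \<in> word_prod ` lists \<G>" "dist y x < r"
      using r unfolding closure_approachable by metis
    then show ?thesis by blast
  qed
  then obtain f where f: "\<And>x. x \<in> k \<Longrightarrow> f x \<in> lists \<G> \<and> dist (word_prod (f x)) x < r"
    by metis
  have "\<exists>w\<in>f ` k. opnorm (word_prod w - U) \<le> \<epsilon>" if U: "U \<in> SU2" for U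
  proof -
    obtain x where x: "x \<in> k" "dist x U < r"
      using k(3) U closure_subset[of SU2] by force
    have "norm (word_prod (f x) - U) < 2 * r"
      using f[OF x(1)] x(2) dist_triangle[of "word_prod (f x)" U x] by (simp add: dist_norm)
    then show ?thesis
      using opnorm_le_norm[of "word_prod (f x) - U"] x(1) by (force simp: r_def)
  qed
  then have "word_net \<G> \<epsilon> (f ` k)"
    using f k(1) by (auto simp: word_net_def)
  then show ?thesis ..
qed

section \<open>Pauli conjugation and the approximate inverse word\<close>

definition iX :: cmat2 where "iX = mat \<i> ** pauli_X"
definition iY :: cmat2 where "iY = mat \<i> ** pauli_Y"

lemma iX_iY_components:
  "iX$1$1 = 0" "iX$1$2 = \<i>" "iX$2$1 = \<i>" "iX$2$2 = 0"
  "iY$1$1 = 0" "iY$1$2 = 1" "iY$2$1 = - 1" "iY$2$2 = 0"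
  by (simp_all add: iX_def iY_def cmat2_mult_component mat_def pauli_X_def pauli_Y_def)

lemma dagger_iX: "dagger iX = - iX" and dagger_iY: "dagger iY = - iY"
  by (simp_all add: cmat2_eq_iff dagger_component iX_iY_components)

lemma iX_iX: "iX ** iX = - mat 1" and iY_iY: "iY ** iY = - mat 1"
  and iY_iX: "iY ** iX = - (iX ** iY)"
  by (simp_all add: cmat2_eq_iff cmat2_mult_component iX_iY_components mat_def)

lemma iX_SU2: "iX \<in> SU2" and iY_SU2: "iY \<in> SU2"
  by (simp_all add: SU2_def dagger_iX dagger_iY cmat2_minus_mult cmat2_mult_minus
    iX_iX iY_iY det_2 iX_iY_components)

text \<open>Rewrite rules that move \<open>iX\<close> in front of \<open>iY\<close> and cancel
  squares inside right-associated products.\<close>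

lemma iX_iX_left: "iX ** (iX ** (M :: cmat2)) = - M" and iY_iY_left: "iY ** (iY ** M) = - M"
  and iY_iX_left: "iY ** (iX ** M) = - (iX ** (iY ** M))"
  by (simp_all add: matrix_mul_assoc iX_iX iY_iY iY_iX cmat2_minus_mult)

definition conj_by :: "cmat2 \<Rightarrow> cmat2 \<Rightarrow> cmat2" where
  "conj_by R A = R ** A ** dagger R"

lemma conj_by_SU2: "R \<in> SU2 \<Longrightarrow> A \<in> SU2 \<Longrightarrow> conj_by R A \<in> SU2"
  by (simp add: conj_by_def SU2_mult SU2_dagger)

lemma opnorm_conj_by_diff_one:
  assumes "R \<in> SU2" shows "opnorm (conj_by R A - mat 1) = opnorm (A - mat 1)"
proof -
  have "conj_by R A - mat 1 = R ** (A - mat 1) ** dagger R"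
    by (simp add: conj_by_def cmat2_ring_simps SU2_mult_dagger[OF assms])
  then show ?thesis by (simp add: opnorm_mult_SU2 assms SU2_dagger)
qed

text \<open>As a quaternion, \<open>A\<close> has a scalar part and three imaginary parts.
  Conjugation by each nontrivial Pauli unit flips two of the imaginary parts, so only four times the
  scalar part survives, and \<open>A + dagger A\<close> is twice the scalar part.\<close>

lemma pauli_twirl:
  assumes "A \<in> SU2"
  shows "A + conj_by iX A + conj_by iY A + conj_by (iX ** iY) A = (A + dagger A) + (A + dagger A)"
proof -
  have "\<i> * z * \<i> = - z" for z by (simp add: mult.commute)
  then show ?thesis
    using SU2_entries[OF assms]
    by (simp add: cmat2_eq_iff cmat2_mult_component conj_by_def dagger_component iX_iY_components)
qed

text \<open>The trace of \<open>A - I\<close> is quadratically small for \<open>A\<close> in \<open>SU(2)\<close>, because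
  \<open>A + dagger A - 2 I = - (dagger A - I) (A - I)\<close>.\<close>
lemma opnorm_pauli_twirl_diff:
  assumes "A \<in> SU2" "opnorm (A - mat 1) \<le> a"
  shows "opnorm ((A - mat 1) + (conj_by iX A - mat 1) + (conj_by iY A - mat 1)
    + (conj_by (iX ** iY) A - mat 1)) \<le> 2 * a\<^sup>2" (is "opnorm ?S \<le> _")
proof -
  define B where "B = (dagger A - mat 1) ** (A - mat 1)"
  have "?S = (A + conj_by iX A + conj_by iY A + conj_by (iX ** iY) A)
      - (mat 1 + mat 1 + mat 1 + mat 1)" by simp
  also have "\<dots> = (A + dagger A - mat 1 - mat 1) + (A + dagger A - mat 1 - mat 1)"
    by (simp only: pauli_twirl[OF assms(1)]) simp
  also have "A + dagger A - mat 1 - mat 1 = - B"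
    by (simp add: B_def cmat2_ring_simps SU2_dagger_mult[OF assms(1)])
  finally have "?S = - (B + B)" by simp
  moreover have "opnorm (dagger A - mat 1) \<le> a"
    using opnorm_dagger_diff[OF assms(1) SU2_one] assms(2) by simp
  then have "opnorm B \<le> a\<^sup>2"
    unfolding B_def power2_eq_square by (rule opnorm_mult_le) (rule assms(2))
  then have "opnorm (B + B) \<le> 2 * a\<^sup>2" using opnorm_add[of B B] by simp
  ultimately show ?thesis by (simp only: opnorm_minus)
qed

text \<open>Multiplication by factors in \<open>SU2\<close> preserves the norm, so errors add
  linearly without any smallness of \<open>a\<close>. The second bound isolates the first-order sum,
  to which the twirl is then applied.\<close>

lemma word_prod_first_order:
  fixes a :: real
  assumes "\<forall>M\<in>set Ms. opnorm (M - mat 1) \<le> a" "set Ms \<subseteq> SU2" "0 \<le> a"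
  shows "opnorm (word_prod Ms - mat 1) \<le> real (length Ms) * a"
    and "opnorm (word_prod Ms - mat 1 - (\<Sum>M\<leftarrow>Ms. M - mat 1)) \<le> (real (length Ms))\<^sup>2 * a\<^sup>2"
  using assms
proof (induction Ms)
  case Nil
  { case 1 show ?case by (simp add: word_prod_def) }
  { case 2 show ?case by (simp add: word_prod_def) }
next
  case (Cons M Ms)
  define p k where "p = word_prod Ms" "k = real (length Ms)"
  have w: "word_prod (M # Ms) = M ** p" by (simp add: word_prod_def p_k_def)
  { case 1
    then have "opnorm (p - mat 1) \<le> k * a" "opnorm (M - mat 1) \<le> a" "M \<in> SU2"
      using Cons by (auto simp: p_k_def)
    moreover have "M ** p - mat 1 = M ** (p - mat 1) + (M - mat 1)"
      by (simp add: cmat2_ring_simps)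
    ultimately show ?case
      using opnorm_add[of "M ** (p - mat 1)" "M - mat 1"]
      by (simp add: w p_k_def opnorm_mult_SU2 algebra_simps) }
  { case 2
    define s where "s = (\<Sum>M\<leftarrow>Ms. M - mat 1)"
    have *: "opnorm (p - mat 1) \<le> k * a" "opnorm (p - mat 1 - s) \<le> k\<^sup>2 * a\<^sup>2"
      "opnorm (M - mat 1) \<le> a"
      using Cons 2 by (auto simp: p_k_def s_def)
    \<comment> \<open>Prepending \<open>M\<close> adds to the old remainder only the product of two
      first-order terms.\<close>
    have "word_prod (M # Ms) - mat 1 - (\<Sum>M\<leftarrow>M # Ms. M - mat 1)
        = (M - mat 1) ** (p - mat 1) + (p - mat 1 - s)"
      by (simp add: w s_def cmat2_ring_simps)
    also have "opnorm \<dots> \<le> a * (k * a) + k\<^sup>2 * a\<^sup>2"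
      using opnorm_add opnorm_mult_le[OF *(3,1)] *(2) by (smt (verit))
    also have "\<dots> \<le> (k + 1)\<^sup>2 * a\<^sup>2"
      using 2 by (simp add: p_k_def power2_eq_square algebra_simps)
    finally show ?case by (simp add: p_k_def algebra_simps) }
qed

text \<open>Let \<open>R\<close> be the product of the Pauli letters read so far. Each perturbation
  becomes its conjugate by \<open>R\<close>, and the sign of \<open>R\<close> does not matter. Up to
  sign, \<open>R\<close> runs through \<open>iX\<close>, \<open>iX ** iY\<close>, \<open>iY\<close>,
  \<open>mat 1\<close>, \<open>iY\<close>, \<open>iX ** iY\<close>, \<open>iX\<close>,
  \<open>mat 1\<close>. The product of all Pauli letters is exactly \<open>mat 1\<close>, so nothing
  is left over at the end.\<close>

lemma inverse_word_conj:
  fixes A B :: cmat2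
  shows "iX ** A ** iY ** B ** iX ** A ** iY ** B ** iY ** B ** iX ** A ** iY ** B ** iX ** A
   = word_prod [conj_by iX A, conj_by (iX ** iY) B, conj_by iY A, B,
       conj_by iY B, conj_by (iX ** iY) A, conj_by iX B, A]"
  by (simp add: word_prod_def conj_by_def dagger_mult dagger_iX dagger_iY
    cmat2_minus_mult cmat2_mult_minus iX_iX_left iY_iY_left iY_iX_left matrix_mul_assoc[symmetric])

text \<open>Each of the perturbations \<open>A\<close> and \<open>B\<close> occurs exactly once in every Pauli frame, so that
  the first-order terms combine to two Pauli twirls.\<close>
lemma opnorm_inverse_word:
  assumes SU2: "word_prod x \<in> SU2" "word_prod y \<in> SU2" "word_prod t \<in> SU2" "word_prod h \<in> SU2"
    and h: "opnorm (word_prod h - dagger (word_prod t)) \<le> \<epsilon>"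
    and x: "opnorm (word_prod x - iX) \<le> \<epsilon>" and y: "opnorm (word_prod y - iY) \<le> \<epsilon>"
  shows "opnorm (word_prod (inverse_word x y t h) - dagger (word_prod t)) \<le> 272 * \<epsilon>\<^sup>2"
proof -
  define X Y T H where "X = word_prod x" "Y = word_prod y" "T = word_prod t" "H = word_prod h"
  define A B where "A = dagger iX ** X ** H ** T" "B = dagger iY ** Y"
  note S = SU2[folded X_Y_T_H_def] and h = h[folded X_Y_T_H_def]
    and x = x[folded X_Y_T_H_def] and y = y[folded X_Y_T_H_def]
  have AB: "A \<in> SU2" "B \<in> SU2"
    unfolding A_B_def by (intro SU2_mult SU2_dagger S iX_SU2 iY_SU2)+
  have \<epsilon>: "0 \<le> \<epsilon>" using opnorm_nonneg h by (rule order_trans)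
  have 1: "opnorm (H ** T - mat 1) \<le> \<epsilon>"
  proof -
    have "H ** T - mat 1 = (H - dagger T) ** T"
      by (simp add: cmat2_ring_simps SU2_dagger_mult S)
    then show ?thesis using h S by (simp add: opnorm_mult_SU2)
  qed
  have 2: "opnorm (dagger R ** Z - mat 1) \<le> \<epsilon>" if "R \<in> SU2" "opnorm (Z - R) \<le> \<epsilon>" for R Z
  proof -
    have "dagger R ** Z - mat 1 = dagger R ** (Z - R)"
      by (simp add: cmat2_ring_simps SU2_dagger_mult that)
    then show ?thesis using that by (simp add: opnorm_mult_SU2 SU2_dagger)
  qed
  have "opnorm ((dagger iX ** X) ** (H ** T) - mat 1 ** mat 1) \<le> \<epsilon> + \<epsilon>"
    by (intro opnorm_mult_diff_le 1 2 x SU2_mult SU2_dagger SU2_one S iX_SU2)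
  then have A: "opnorm (A - mat 1) \<le> 2 * \<epsilon>"
    by (simp add: A_B_def matrix_mul_assoc)
  have "opnorm (B - mat 1) \<le> \<epsilon>"
    unfolding A_B_def by (intro 2 y iY_SU2)
  then have B: "opnorm (B - mat 1) \<le> 2 * \<epsilon>" using \<epsilon> by simp
  have PA: "X ** (H ** (T ** M)) = iX ** (A ** M)" "Y ** M = iY ** (B ** M)" for M
    by (simp_all add: A_B_def matrix_mul_assoc[symmetric] SU2_mult_dagger_left iX_SU2 iY_SU2)
  \<comment> \<open>The inverse word ends in \<open>H\<close> without a following \<open>T\<close>.
    Inserting \<open>T ** dagger T\<close> completes the last block and leaves the desired
    \<open>dagger T\<close> on the right.\<close>
  have H: "H = H ** (T ** dagger T)" by (simp add: SU2_mult_dagger S)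
  define Ms where "Ms = [conj_by iX A, conj_by (iX ** iY) B, conj_by iY A, B,
       conj_by iY B, conj_by (iX ** iY) A, conj_by iX B, A]"
  have "word_prod (inverse_word x y t h) =
      X ** (H ** (T ** (Y ** (X ** (H ** (T ** (Y ** (Y ** (X ** (H ** (T ** (Y **
      (X ** (H ** (T ** dagger T)))))))))))))))"
    by (simp add: inverse_word_def word_prod_append matrix_mul_assoc[symmetric]
        H[symmetric] flip: X_Y_T_H_def)
  also have "\<dots> = word_prod Ms ** dagger T"
    unfolding PA Ms_def inverse_word_conj[symmetric] by (simp add: matrix_mul_assoc)
  finally have w: "word_prod (inverse_word x y t h) = word_prod Ms ** dagger T" .
  have Ms: "\<forall>M\<in>set Ms. opnorm (M - mat 1) \<le> 2 * \<epsilon>" "set Ms \<subseteq> SU2"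
    using A B AB by (simp_all add: Ms_def opnorm_conj_by_diff_one conj_by_SU2 iX_SU2 iY_SU2 SU2_mult)
  define s where "s = (\<Sum>M\<leftarrow>Ms. M - mat 1)"
  \<comment> \<open>Eight factors, each within \<open>2 * \<epsilon>\<close> of the identity, give
    64 times 4.\<close>
  have "opnorm (word_prod Ms - mat 1 - s) \<le> 256 * \<epsilon>\<^sup>2"
    using word_prod_first_order(2)[OF Ms] \<epsilon> by (simp add: s_def Ms_def power2_eq_square)
  \<comment> \<open>The first-order sum regroups into one twirl of \<open>A\<close> and one of
    \<open>B\<close>, each contributing \<open>2 * (2 * \<epsilon>)\<^sup>2\<close>.\<close>
  moreover have "opnorm s \<le> 16 * \<epsilon>\<^sup>2"
  proof -
    have "s = ((A - mat 1) + (conj_by iX A - mat 1) + (conj_by iY A - mat 1)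
        + (conj_by (iX ** iY) A - mat 1)) + ((B - mat 1) + (conj_by iX B - mat 1)
        + (conj_by iY B - mat 1) + (conj_by (iX ** iY) B - mat 1))"
      by (simp add: s_def Ms_def)
    also have "opnorm \<dots> \<le> 2 * (2 * \<epsilon>)\<^sup>2 + 2 * (2 * \<epsilon>)\<^sup>2"
      by (intro order_trans[OF opnorm_add] add_mono opnorm_pauli_twirl_diff AB A B)
    finally show ?thesis by (simp add: power2_eq_square)
  qed
  ultimately have "opnorm (word_prod Ms - mat 1) \<le> 272 * \<epsilon>\<^sup>2"
    using opnorm_add[of "word_prod Ms - mat 1 - s" s] by simp
  moreover have "word_prod Ms ** dagger T - dagger T = (word_prod Ms - mat 1) ** dagger T"
    by (simp add: cmat2_ring_simps)
  ultimately show ?thesis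
    using S by (simp add: w opnorm_mult_SU2 SU2_dagger flip: X_Y_T_H_def)
qed

section \<open>Stability of group commutators and one recursion step\<close>

lemma opnorm_commutator_diff:
  assumes SU2: "V \<in> SU2" "W \<in> SU2" "V' \<in> SU2" "W' \<in> SU2"
    and \<eta>: "opnorm (V - mat 1) \<le> \<eta>" "opnorm (W - mat 1) \<le> \<eta>"
    and \<epsilon>: "opnorm (V' - V) \<le> \<epsilon>" "opnorm (W' - W) \<le> \<epsilon>"
  shows "opnorm (V' ** W' ** dagger V' ** dagger W' - V ** W ** dagger V ** dagger W)
    \<le> 4 * \<epsilon> * \<eta> + 2 * \<epsilon>\<^sup>2 + 4 * \<eta>\<^sup>2 * \<epsilon>"
proof -
  define v w v' w' where "v = V - mat 1" "w = W - mat 1" "v' = V' - mat 1" "w' = W' - mat 1"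
  note d = v_w_v'_w'_def
  define c c' where "c = v ** w - w ** v" "c' = v' ** w' - w' ** v'"
  define D D' where "D = dagger V ** dagger W" "D' = dagger V' ** dagger W'"
  \<comment> \<open>A group commutator differs from the identity by the additive commutator of
    \<open>P - mat 1\<close> and \<open>R - mat 1\<close>, up to a unitary factor. Errors in
    \<open>P\<close> and \<open>R\<close> are therefore damped by the smallness of the other
    element.\<close>
  have comm: "P ** R ** dagger P ** dagger R - mat 1 =
      ((P - mat 1) ** (R - mat 1) - (R - mat 1) ** (P - mat 1)) ** (dagger P ** dagger R)"
    if "P \<in> SU2" "R \<in> SU2" for P R
  proof -
    have "R ** P ** (dagger P ** dagger R) = mat 1"
      by (simp add: matrix_mul_assoc[symmetric] SU2_mult_dagger_left SU2_mult_dagger that)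
    moreover have "(P - mat 1) ** (R - mat 1) - (R - mat 1) ** (P - mat 1) = P ** R - R ** P"
      by (simp add: cmat2_ring_simps)
    ultimately show ?thesis by (simp only: cmat2_diff_mult matrix_mul_assoc)
  qed
  have DS: "D' \<in> SU2" using SU2 by (simp add: D_D'_def SU2_mult SU2_dagger)
  have dv: "opnorm (v' - v) \<le> \<epsilon>" "opnorm (w' - w) \<le> \<epsilon>" using \<epsilon> by (simp_all add: d)
  have v: "opnorm v \<le> \<eta>" "opnorm w \<le> \<eta>" using \<eta> by (simp_all add: d)
  have v': "opnorm w' \<le> \<eta> + \<epsilon>" "opnorm v' \<le> \<eta> + \<epsilon>"
    using opnorm_add[of "w' - w" w] opnorm_add[of "v' - v" v] v dv by simp_all
  \<comment> \<open>Each of the four terms pairs an error of size \<open>\<epsilon>\<close> with a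
    factor of size at most \<open>\<eta>\<close> or \<open>\<eta> + \<epsilon>\<close>.\<close>
  have "c' - c = (v' - v) ** w' + v ** (w' - w) - ((w' - w) ** v' + w ** (v' - v))"
    by (simp add: c_c'_def cmat2_ring_simps)
  also have "opnorm \<dots> \<le> (opnorm ((v' - v) ** w') + opnorm (v ** (w' - w)))
      + (opnorm ((w' - w) ** v') + opnorm (w ** (v' - v)))"
    by (intro order_trans[OF opnorm_diff] add_mono opnorm_add)
  also have "\<dots> \<le> (\<epsilon> * (\<eta> + \<epsilon>) + \<eta> * \<epsilon>) + (\<epsilon> * (\<eta> + \<epsilon>) + \<eta> * \<epsilon>)"
    by (intro add_mono opnorm_mult_le dv v v')
  finally have c': "opnorm (c' - c) \<le> 4 * \<epsilon> * \<eta> + 2 * \<epsilon>\<^sup>2"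
    by (simp add: power2_eq_square algebra_simps)
  have "opnorm c \<le> \<eta> * \<eta> + \<eta> * \<eta>"
    unfolding c_c'_def by (intro order_trans[OF opnorm_diff] add_mono opnorm_mult_le v)
  moreover have "opnorm (D' - D) \<le> \<epsilon> + \<epsilon>"
    unfolding D_D'_def
    by (intro opnorm_mult_diff_le SU2_dagger SU2) (simp_all add: opnorm_dagger_diff SU2 \<epsilon>)
  ultimately have "opnorm (c ** (D' - D)) \<le> (\<eta> * \<eta> + \<eta> * \<eta>) * (\<epsilon> + \<epsilon>)"
    by (rule opnorm_mult_le)
  moreover have "V' ** W' ** dagger V' ** dagger W' - V ** W ** dagger V ** dagger W
      = (c' - c) ** D' + c ** (D' - D)"
  proof -
    have "V' ** W' ** dagger V' ** dagger W' - V ** W ** dagger V ** dagger W = c' ** D' - c ** D"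
      using arg_cong2[OF comm[OF SU2(3,4)] comm[OF SU2(1,2)], of "(-)"]
      unfolding c_c'_def D_D'_def d by simp
    then show ?thesis by (simp add: cmat2_diff_mult cmat2_mult_diff)
  qed
  ultimately show ?thesis
    using opnorm_add[of "(c' - c) ** D'" "c ** (D' - D)"] c'
    by (simp add: opnorm_mult_SU2 DS power2_eq_square algebra_simps)
qed

lemma approx_group_commutator_mono:
  assumes "approx_group_commutator C gc" "C \<le> C'"
  shows "approx_group_commutator C' gc"
proof -
  have *: "C * \<delta> powr p \<le> C' * \<delta> powr p" for \<delta> p :: real
    using assms(2) by (intro mult_right_mono) simp_all
  show ?thesis
    using assms(1) unfolding approx_group_commutator_def
    by (fastforce intro: order_trans[OF _ *] split: prod.splits)
qed

text \<open>The approximate inverses, the perturbed commutator and the commutator subroutine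
  contribute errors of order 2, 3/2 and 3/2 in \<open>\<epsilon>\<close>; for
  \<open>\<epsilon> \<le> 1\<close> the order 3/2 dominates.\<close>

lemma ifsk_step:
  assumes gc: "approx_group_commutator C gc" and C: "0 \<le> C" and \<G>: "\<G> \<subseteq> SU2"
    and prev: "\<And>U. U \<in> SU2 \<Longrightarrow> ifsk base gc n U \<in> lists \<G>"
      "\<And>U. U \<in> SU2 \<Longrightarrow> length (ifsk base gc n U) \<le> l"
      "\<And>U. U \<in> SU2 \<Longrightarrow> opnorm (word_prod (ifsk base gc n U) - U) \<le> \<epsilon>"
    and \<epsilon>: "\<epsilon> \<le> 1" and U: "U \<in> SU2"
  shows "ifsk base gc (Suc n) U \<in> lists \<G>"
    and "length (ifsk base gc (Suc n) U) \<le> 33 * l"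
    and "opnorm (word_prod (ifsk base gc (Suc n) U) - U) \<le> (546 + 5 * C + 4 * C\<^sup>2) * \<epsilon> powr (3/2)"
proof -
  define f where "f = ifsk base gc n"
  note prev = prev[folded f_def]
  have prevS: "word_prod (f M) \<in> SU2" if "M \<in> SU2" for M
    using prev(1)[OF that] \<G> word_prod_SU2 lists_mono by blast
  define \<Delta> where "\<Delta> = U ** dagger (word_prod (f U))"
  obtain V W where VW: "gc \<Delta> = (V, W)" by fastforce
  define v w where "v = f V" "w = f W"
  define vh wh where "vh = f (dagger (word_prod v))" "wh = f (dagger (word_prod w))"
  define x y where "x = f iX" "y = f iY"
  have unfold: "ifsk base gc (Suc n) U =
      v @ w @ inverse_word x y v vh @ inverse_word x y w wh @ f U"
    by (simp add: VW \<Delta>_def[symmetric] Let_def flip: f_def iX_def iY_def v_w_def vh_wh_def x_y_def)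
  have \<epsilon>0: "0 \<le> \<epsilon>" using opnorm_nonneg prev(3)[OF U] by (rule order_trans)
  have \<Delta>: "\<Delta> \<in> SU2" by (simp add: \<Delta>_def SU2_mult SU2_dagger U prevS)
  have "\<Delta> - mat 1 = (U - word_prod (f U)) ** dagger (word_prod (f U))"
    by (simp add: \<Delta>_def cmat2_ring_simps SU2_mult_dagger prevS U)
  then have "opnorm (\<Delta> - mat 1) \<le> \<epsilon>"
    using prev(3)[OF U] by (simp add: opnorm_mult_SU2 SU2_dagger prevS U opnorm_minus_commute)
  then have VW_bounds: "V \<in> SU2" "W \<in> SU2"
    "opnorm (V ** W ** dagger V ** dagger W - \<Delta>) \<le> C * \<epsilon> powr (3/2)"
    "opnorm (V - mat 1) \<le> C * \<epsilon> powr (1/2)" "opnorm (W - mat 1) \<le> C * \<epsilon> powr (1/2)"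
    using gc \<Delta> VW unfolding approx_group_commutator_def by force+
  have vwS: "word_prod v \<in> SU2" "word_prod w \<in> SU2"
    by (simp_all add: v_w_def prevS VW_bounds)
  note args = VW_bounds(1,2) SU2_dagger[OF vwS(1)] SU2_dagger[OF vwS(2)] iX_SU2 iY_SU2 U
  have words: "set u \<subseteq> \<G> \<and> length u \<le> l" if "u \<in> {v, w, vh, wh, x, y, f U}" for u
    using that prev(1,2) args unfolding v_w_def vh_wh_def x_y_def by auto
  show "ifsk base gc (Suc n) U \<in> lists \<G>"
    unfolding unfold using words by (auto simp: inverse_word_def)
  \<comment> \<open>Each inverse word consists of 15 blocks; with \<open>v\<close>, \<open>w\<close>
    and \<open>f U\<close> this makes \<open>2 * 15 + 3 = 33\<close>.\<close>
  show "length (ifsk base gc (Suc n) U) \<le> 33 * l"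
    unfolding unfold using words[of v] words[of w] words[of vh] words[of wh] words[of x]
      words[of y] words[of "f U"] by (simp add: inverse_word_def)
  have S: "word_prod vh \<in> SU2" "word_prod wh \<in> SU2" "word_prod x \<in> SU2" "word_prod y \<in> SU2"
    unfolding vh_wh_def x_y_def by (intro prevS args)+
  define V1 W1 where "V1 = word_prod v" "W1 = word_prod w"
  define Vi Wi where "Vi = word_prod (inverse_word x y v vh)" "Wi = word_prod (inverse_word x y w wh)"
  note VW1S = vwS[folded V1_W1_def]
  have "inverse_word x y v vh \<in> lists \<G>" "inverse_word x y w wh \<in> lists \<G>"
    using words by (auto simp: inverse_word_def)
  then have ViS: "Vi \<in> SU2" "Wi \<in> SU2"
    using \<G> lists_mono unfolding Vi_Wi_def by (blast intro: word_prod_SU2)+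
  \<comment> \<open>\<open>vh\<close> and \<open>wh\<close> target the inverses of the products
    actually obtained, not of \<open>V\<close> and \<open>W\<close>, so the depth-\<open>n\<close>
    error bound applies to them directly.\<close>
  have inv: "opnorm (Vi - dagger V1) \<le> 272 * \<epsilon>\<^sup>2" "opnorm (Wi - dagger W1) \<le> 272 * \<epsilon>\<^sup>2"
    unfolding Vi_Wi_def V1_W1_def
    by (intro opnorm_inverse_word S vwS;
        unfold vh_wh_def x_y_def; intro prev(3) args)+
  \<comment> \<open>With the square root as variable, all error terms become polynomials.\<close>
  define s where "s = sqrt \<epsilon>"
  have s: "0 \<le> s" "s \<le> 1" "s\<^sup>2 = \<epsilon>" using \<epsilon> \<epsilon>0 by (simp_all add: s_def)
  have powr: "\<epsilon> powr (1/2) = s" "\<epsilon> powr (3/2) = s ^ 3"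
  proof -
    show 1: "\<epsilon> powr (1/2) = s" by (simp add: s_def powr_half_sqrt \<epsilon>0)
    have "\<epsilon> powr (3/2) = (\<epsilon> powr (1/2)) powr 3" by (simp add: powr_powr)
    also have "\<dots> = s ^ 3" unfolding 1 using s(1) powr_realpow'[of s 3] by simp
    finally show "\<epsilon> powr (3/2) = s ^ 3" .
  qed
  have "opnorm (V1 ** W1 ** Vi ** Wi - V1 ** W1 ** dagger V1 ** dagger W1) \<le> 544 * \<epsilon>\<^sup>2"
  proof -
    have "V1 ** W1 ** Vi ** Wi - V1 ** W1 ** dagger V1 ** dagger W1
        = V1 ** W1 ** (Vi ** Wi - dagger V1 ** dagger W1)"
      by (simp add: cmat2_ring_simps)
    moreover have "opnorm (Vi ** Wi - dagger V1 ** dagger W1) \<le> 272 * \<epsilon>\<^sup>2 + 272 * \<epsilon>\<^sup>2"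
      by (intro opnorm_mult_diff_le ViS SU2_dagger VW1S inv)
    ultimately show ?thesis by (simp add: opnorm_mult_SU2 VW1S SU2_mult)
  qed
  moreover have "opnorm (V1 ** W1 ** dagger V1 ** dagger W1 - V ** W ** dagger V ** dagger W)
      \<le> 4 * \<epsilon> * (C * s) + 2 * \<epsilon>\<^sup>2 + 4 * (C * s)\<^sup>2 * \<epsilon>"
    using VW_bounds(4,5) prev(3) VW_bounds(1,2) unfolding powr
    by (intro opnorm_commutator_diff VW_bounds VW1S) (simp_all add: V1_W1_def v_w_def)
  moreover have "V1 ** W1 ** Vi ** Wi - \<Delta> =
      (V1 ** W1 ** Vi ** Wi - V1 ** W1 ** dagger V1 ** dagger W1)
      + (V1 ** W1 ** dagger V1 ** dagger W1 - V ** W ** dagger V ** dagger W)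
      + (V ** W ** dagger V ** dagger W - \<Delta>)" by simp
  ultimately have "opnorm (V1 ** W1 ** Vi ** Wi - \<Delta>)
      \<le> 544 * \<epsilon>\<^sup>2 + (4 * \<epsilon> * (C * s) + 2 * \<epsilon>\<^sup>2 + 4 * (C * s)\<^sup>2 * \<epsilon>) + C * s ^ 3"
    using VW_bounds(3) opnorm_add unfolding powr by (smt (verit))
  \<comment> \<open>The coefficient 546 is 544 from the two inverse words plus 2 from the commutator
    perturbation; \<open>5 * C\<close> is \<open>4 * C\<close> from that perturbation plus
    \<open>C\<close> from the subroutine.\<close>
  also have "\<dots> = (546 + 4 * C\<^sup>2) * s ^ 4 + 5 * C * s ^ 3"
    unfolding s(3)[symmetric] by (simp add: algebra_simps power_numeral_reduce)
  also have "\<dots> \<le> (546 + 4 * C\<^sup>2) * s ^ 3 + 5 * C * s ^ 3"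
    using s by (intro add_right_mono mult_left_mono power_decreasing) simp_all
  finally have "opnorm (V1 ** W1 ** Vi ** Wi - \<Delta>) \<le> (546 + 5 * C + 4 * C\<^sup>2) * s ^ 3"
    by (simp add: algebra_simps)
  \<comment> \<open>Right multiplication by the previous approximation turns \<open>\<Delta>\<close>
    back into \<open>U\<close> and preserves the error.\<close>
  moreover have "word_prod (ifsk base gc (Suc n) U) - U = (V1 ** W1 ** Vi ** Wi - \<Delta>) ** word_prod (f U)"
  proof -
    have "\<Delta> ** word_prod (f U) = U"
      by (simp add: \<Delta>_def matrix_mul_assoc[symmetric] SU2_dagger_mult prevS U)
    then show ?thesis
      unfolding unfold
      by (simp add: word_prod_append cmat2_diff_mult matrix_mul_assoc flip: V1_W1_def Vi_Wi_def)
  qed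
  ultimately show "opnorm (word_prod (ifsk base gc (Suc n) U) - U)
      \<le> (546 + 5 * C + 4 * C\<^sup>2) * \<epsilon> powr (3/2)"
    by (simp only: powr) (simp add: opnorm_mult_SU2 prevS U)
qed

section \<open>Iteration of the recursion and choice of the depth\<close>

lemma ifsk_bounds:
  assumes gc: "approx_group_commutator C gc" and C: "0 \<le> C" and \<G>: "\<G> \<subseteq> SU2"
    and D: "D = 546 + 5 * C + 4 * C\<^sup>2"
    and base: "\<And>U. U \<in> SU2 \<Longrightarrow> base U \<in> lists \<G>"
      "\<And>U. U \<in> SU2 \<Longrightarrow> length (base U) \<le> l"
      "\<And>U. U \<in> SU2 \<Longrightarrow> opnorm (word_prod (base U) - U) \<le> exp (- 1) / D\<^sup>2"
    and U: "U \<in> SU2"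
  shows "ifsk base gc n U \<in> lists \<G> \<and> length (ifsk base gc n U) \<le> 33 ^ n * l \<and>
    opnorm (word_prod (ifsk base gc n U) - U) \<le> exp (- ((3/2) ^ n)) / D\<^sup>2"
  using U
proof (induction n arbitrary: U)
  case 0
  then show ?case using base by simp
next
  case (Suc n)
  define e where "e = exp (- ((3/2) ^ n)) / D\<^sup>2"
  have D1: "1 \<le> D" using C by (simp add: D)
  have "e \<le> 1"
    unfolding e_def using D1 by (simp add: divide_le_eq order_trans[of _ 1] one_le_power)
  \<comment> \<open>Scaling by \<open>D\<^sup>2\<close> absorbs the constant:
    \<open>D\<^sup>2 * (D * e powr (3/2)) = (D\<^sup>2 * e) powr (3/2)\<close>. Each level thus
    multiplies the exponent of the scaled error by 3/2.\<close>
  have "D * e powr (3/2) = exp (- ((3/2) ^ Suc n)) / D\<^sup>2"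
  proof -
    have "D\<^sup>2 powr (3/2) = D ^ 3"
      using D1 by (simp add: powr_powr flip: powr_numeral)
    moreover have "exp (- ((3/2) ^ n)) powr (3/2) = exp (- ((3/2) ^ Suc n :: real))"
      by (simp add: powr_def)
    ultimately show ?thesis
      using D1 by (simp add: e_def powr_divide power2_eq_square power3_eq_cube)
  qed
  then show ?case
    using ifsk_step[OF gc C \<G>, of base n "33 ^ n * l" e U, folded D] Suc \<open>e \<le> 1\<close>
    by (simp add: e_def del: ifsk.simps)
qed

text \<open>Rounding the depth up to an integer overshoots the target by at most one factor
  \<open>b\<close>, which costs only a constant in the length.\<close>

lemma exists_power_between:
  assumes "1 < b" "1 \<le> t"
  obtains n where "t \<le> b ^ n" "b ^ n \<le> b * (t :: real)"
proof -
  define n where "n = nat \<lceil>log b t\<rceil>"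
  have "0 \<le> log b t" using assms by simp
  then have n: "log b t \<le> n" "n \<le> 1 + log b t" unfolding n_def by linarith+
  have "t = b powr log b t" using assms by simp
  also have "\<dots> \<le> b powr n" using assms n by (intro powr_mono) simp_all
  finally have "t \<le> b ^ n" using assms by (simp add: powr_realpow)
  moreover have "b ^ n = b powr n" using assms by (simp add: powr_realpow)
  moreover have "b powr n \<le> b powr (1 + log b t)" using assms n by (intro powr_mono) simp_all
  moreover have "\<dots> = b * t" using assms by (simp add: powr_add)
  ultimately show thesis using that by metis
qed

theorem theorem3p1:
  fixes C :: real
  shows "\<exists>\<epsilon>max>0. \<forall>\<epsilon>\<^sub>0. 0 < \<epsilon>\<^sub>0 \<and> \<epsilon>\<^sub>0 \<le> \<epsilon>max \<longrightarrow>
    (\<forall>\<G>. finite \<G> \<and> \<G> \<subseteq> SU2 \<and> universal \<G> \<longrightarrow>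
      (\<exists>N. word_net \<G> \<epsilon>\<^sub>0 N) \<and>
      (\<forall>gc N base. approx_group_commutator C gc \<and> word_net \<G> \<epsilon>\<^sub>0 N \<and> net_lookup N \<epsilon>\<^sub>0 base \<longrightarrow>
        (\<exists>K. \<forall>\<^sub>F \<epsilon> in at_right 0. \<exists>n. \<forall>U\<in>SU2.
            ifsk base gc n U \<in> lists \<G> \<and>
            real (length (ifsk base gc n U)) \<le> K * ln (1 / \<epsilon>) powr (ln 33 / ln (3/2)) \<and>
            opnorm (word_prod (ifsk base gc n U) - U) \<le> \<epsilon>)))"
proof -
  \<comment> \<open>\<open>C\<close> is an arbitrary real, whereas the recursion step takes a
    nonnegative constant; \<open>D\<close> is the constant of that step.\<close>
  define C' D where "C' = max C 0" "D = 546 + 5 * C' + 4 * C'\<^sup>2"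
  define \<gamma> :: real where "\<gamma> = ln 33 / ln (3/2)"
  have D: "1 \<le> D" by (simp add: C'_D_def)
  \<comment> \<open>This identity determines the exponent: it converts the length growth
    \<open>33 ^ n\<close> into \<open>((3/2) ^ n) powr \<gamma>\<close>.\<close>
  have \<gamma>: "(3/2) powr \<gamma> = 33" by (simp add: \<gamma>_def powr_def)
  have \<gamma>0: "0 \<le> \<gamma>" by (simp add: \<gamma>_def)
  have main: "\<exists>K. \<forall>\<^sub>F \<epsilon> in at_right 0. \<exists>n. \<forall>U\<in>SU2.
      ifsk base gc n U \<in> lists \<G> \<and>
      real (length (ifsk base gc n U)) \<le> K * ln (1 / \<epsilon>) powr \<gamma> \<and>
      opnorm (word_prod (ifsk base gc n U) - U) \<le> \<epsilon>"
    if \<epsilon>\<^sub>0: "\<epsilon>\<^sub>0 \<le> exp (- 1) / D\<^sup>2" and \<G>: "\<G> \<subseteq> SU2"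
      and gc: "approx_group_commutator C gc" and N: "word_net \<G> \<epsilon>\<^sub>0 N"
      and base: "net_lookup N \<epsilon>\<^sub>0 base" for \<epsilon>\<^sub>0 \<G> gc N base
  proof -
    define l where "l = Max (length ` N)"
    have l: "length w \<le> l" if "w \<in> N" for w
      using N that by (auto simp: l_def word_net_def)
    have bounds: "ifsk base gc n U \<in> lists \<G> \<and> length (ifsk base gc n U) \<le> 33 ^ n * l \<and>
        opnorm (word_prod (ifsk base gc n U) - U) \<le> exp (- ((3/2) ^ n)) / D\<^sup>2"
      if "U \<in> SU2" for n U
    proof (rule ifsk_bounds[OF _ _ \<G> C'_D_def(2) _ _ _ that])
      show "approx_group_commutator C' gc"
        using gc by (rule approx_group_commutator_mono) (simp add: C'_D_def)
      show "0 \<le> C'" by (simp add: C'_D_def)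
      fix M assume "M \<in> SU2"
      then have M: "base M \<in> N" "opnorm (word_prod (base M) - M) \<le> \<epsilon>\<^sub>0"
        using base by (simp_all add: net_lookup_def)
      show "base M \<in> lists \<G>" using M(1) N by (auto simp: word_net_def)
      show "length (base M) \<le> l" using M(1) by (rule l)
      show "opnorm (word_prod (base M) - M) \<le> exp (- 1) / D\<^sup>2"
        using M(2) \<epsilon>\<^sub>0 by simp
    qed
    have depth: "\<exists>n. \<forall>U\<in>SU2. ifsk base gc n U \<in> lists \<G> \<and>
        real (length (ifsk base gc n U)) \<le> 33 * real l * ln (1 / \<epsilon>) powr \<gamma> \<and>
        opnorm (word_prod (ifsk base gc n U) - U) \<le> \<epsilon>"
      if \<epsilon>: "0 < \<epsilon>" "\<epsilon> < exp (- 1)" for \<epsilon>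
    proof -
      define t where "t = ln (1 / \<epsilon>)"
      have "ln \<epsilon> < ln (exp (- 1))" using \<epsilon> by (subst ln_less_cancel_iff) simp_all
      \<comment> \<open>This is where \<open>\<epsilon> < exp (- 1)\<close> enters; the depth is
        chosen by comparing \<open>t\<close> with powers of 3/2.\<close>
      then have t: "1 \<le> t" using \<epsilon> by (simp add: t_def ln_div)
      obtain n where n: "t \<le> (3/2) ^ n" "(3/2) ^ n \<le> 3/2 * t"
        using exists_power_between[of "3/2" t] t by auto
      have "(33::real) ^ n = ((3/2) powr \<gamma>) ^ n" by (simp only: \<gamma>)
      also have "\<dots> = ((3/2) ^ n) powr \<gamma>"
        by (simp add: powr_powr mult.commute flip: powr_realpow)
      also have "\<dots> \<le> (3/2 * t) powr \<gamma>" using n \<gamma>0 by (intro powr_mono2) simp_all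
      \<comment> \<open>The overshoot by 3/2 in the choice of \<open>n\<close> becomes one factor
        33, so \<open>33 * real l\<close> serves as \<open>K\<close>.\<close>
      also have "\<dots> = 33 * t powr \<gamma>" by (simp only: powr_mult \<gamma>)
      finally have "33 ^ n * real l \<le> 33 * t powr \<gamma> * real l"
        by (rule mult_right_mono) simp
      then have len: "33 ^ n * real l \<le> 33 * real l * t powr \<gamma>"
        by (simp only: mult.assoc mult.commute[of "real l"])
      have "exp (- ((3/2) ^ n)) / D\<^sup>2 \<le> exp (- ((3/2) ^ n))"
        using D by (simp add: divide_le_eq mult_le_cancel_left1 one_le_power)
      also have "\<dots> \<le> exp (- t)" using n by simp
      also have "\<dots> = \<epsilon>" using \<epsilon> by (simp add: t_def ln_div)
      finally have err: "exp (- ((3/2) ^ n)) / D\<^sup>2 \<le> \<epsilon>" .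
      show ?thesis
      proof (intro exI[of _ n] ballI conjI)
        fix U assume U: "U \<in> SU2"
        note U_bounds = bounds[OF U, of n]
        show "ifsk base gc n U \<in> lists \<G>" using U_bounds by blast
        have "real (length (ifsk base gc n U)) \<le> real (33 ^ n * l)"
          using U_bounds by (simp only: of_nat_le_iff)
        then show "real (length (ifsk base gc n U)) \<le> 33 * real l * ln (1 / \<epsilon>) powr \<gamma>"
          using len by (simp add: t_def)
        show "opnorm (word_prod (ifsk base gc n U) - U) \<le> \<epsilon>"
          using U_bounds err by linarith
      qed
    qed
    have "\<forall>\<^sub>F \<epsilon> in at_right 0. \<exists>n. \<forall>U\<in>SU2. ifsk base gc n U \<in> lists \<G> \<and>
        real (length (ifsk base gc n U)) \<le> 33 * real l * ln (1 / \<epsilon>) powr \<gamma> \<and>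
        opnorm (word_prod (ifsk base gc n U) - U) \<le> \<epsilon>"
    proof (rule eventually_at_rightI)
      fix \<epsilon> :: real assume "\<epsilon> \<in> {0<..<exp (- 1)}"
      then have "0 < \<epsilon>" "\<epsilon> < exp (- 1)" by simp_all
      then show "\<exists>n. \<forall>U\<in>SU2. ifsk base gc n U \<in> lists \<G> \<and>
          real (length (ifsk base gc n U)) \<le> 33 * real l * ln (1 / \<epsilon>) powr \<gamma> \<and>
          opnorm (word_prod (ifsk base gc n U) - U) \<le> \<epsilon>"
        by (rule depth)
    qed simp
    then show ?thesis by (rule exI)
  qed
  \<comment> \<open>The threshold depends only on \<open>C\<close>, so it is chosen before the gate
    set, as an absolute constant must be.\<close>
  show ?thesis
    unfolding \<gamma>_def[symmetric]
  proof (rule exI[of _ "exp (- 1) / D\<^sup>2"], intro conjI allI impI)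
    show "0 < exp (- 1) / D\<^sup>2" using D by simp
    fix \<epsilon>\<^sub>0 \<G>
    assume "0 < \<epsilon>\<^sub>0 \<and> \<epsilon>\<^sub>0 \<le> exp (- 1) / D\<^sup>2" "finite \<G> \<and> \<G> \<subseteq> SU2 \<and> universal \<G>"
    then have *: "0 < \<epsilon>\<^sub>0" "\<epsilon>\<^sub>0 \<le> exp (- 1) / D\<^sup>2" "\<G> \<subseteq> SU2" "universal \<G>" by simp_all
    show "\<exists>N. word_net \<G> \<epsilon>\<^sub>0 N" using *(4,1) by (rule word_net_exists)
    fix gc N base
    assume "approx_group_commutator C gc \<and> word_net \<G> \<epsilon>\<^sub>0 N \<and> net_lookup N \<epsilon>\<^sub>0 base"
    then have "approx_group_commutator C gc" "word_net \<G> \<epsilon>\<^sub>0 N" "net_lookup N \<epsilon>\<^sub>0 base"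
      by simp_all
    with *(2,3) show "\<exists>K. \<forall>\<^sub>F \<epsilon> in at_right 0. \<exists>n. \<forall>U\<in>SU2.
        ifsk base gc n U \<in> lists \<G> \<and>
        real (length (ifsk base gc n U)) \<le> K * ln (1 / \<epsilon>) powr \<gamma> \<and>
        opnorm (word_prod (ifsk base gc n U) - U) \<le> \<epsilon>"
      by (rule main)
  qed
qed

end
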